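(* Let $T=(T^{*},T^{\triangle})$ be a spherical latin bitrade. If $a=(a_1,a_2,a_3)\in T^{*}$, $b=(b_1,b_2,b_3)\in T^{*}$ and $i\in\{1,2,3\}$ satisfy $a_i\neq b_i$, then there exist an integer $n\ge 2$ and a homotopy $\varphi=(\varphi_1,\varphi_2,\varphi_3)$ of $T( * )$ into $\mathbb{Z}_n(+)$ with $\varphi_i(a_i)\neq\varphi_i(b_i)$.
   Context: A latin bitrade is a pair $T=(T^{*},T^{\triangle})$ of finite sets of triples satisfying: (R1) $T^{*}\cap T^{\triangle}=\emptyset$; (R2) for every $p\in T^{*}$ and all $r\neq s$ in $\{1,2,3\}$ there is exactly one $q\in T^{\triangle}$ with $p_r=q_r$, $p_s=q_s$; (R3) for every $q\in T^{\triangle}$ and all $r\neq s$ there is exactly one $p\in T^{*}$ with $q_r=p_r$, $q_s=p_s$. First, second, third coordinates (rows, columns, symbols) use pairwise disjoint label sets. $T$ is indecomposable if it is not the disjoint union of two nonempty latin bitrades. With $s=|T^{*}|$, $o_i$ the number of distinct $i$-th coordinates in $T^{*}$ and $m=o_1+o_2+o_3$, $T$ is spherical if it is indecomposable and $m=s+2$. $T( * )$ denotes the partial operation with $u_1*u_2=u_3$ iff $(u_1,u_2,u_3)\in T^{*}$. A homotopy of $T( * )$ into an abelian group $G(+)$ is a triple $(\sigma_1,\sigma_2,\sigma_3)$, where $\sigma_i$ maps the set of $i$-th coordinates of elements of $T^{*}$ into $G$, such that $\sigma_1(u_1)+\sigma_2(u_2)=\sigma_3(u_3)$ for all $(u_1,u_2,u_3)\in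 T^{*}$. *)

theory Defs
  imports "HOL-Algebra.Elementary_Groups"
begin

type_synonym 'a triple = "'a \<times> 'a \<times> 'a"

(* Only used for i in {1, 2, 3}. *)
definition coord :: "nat \<Rightarrow> 'a triple \<Rightarrow> 'a" where
  "coord i p = (case p of (x, y, z) \<Rightarrow> if i = 1 then x else if i = 2 then y else z)"

definition labels :: "nat \<Rightarrow> 'a triple set \<Rightarrow> 'a set" where
  "labels i A = coord i ` A"

(* The last conjunct is the convention that rows, columns and symbols are labelled by
   pairwise disjoint sets. *)
definition latin_bitrade :: "'a triple set \<Rightarrow> 'a triple set \<Rightarrow> bool" where
  "latin_bitrade S D \<longleftrightarrow>
     finite S \<and> finite D \<and>
     S \<inter> D = {} \<and>
     (\<forall>p\<in>S. \<forall>r\<in>{1,2,3}. \<forall>s\<in>{1,2,3}. r \<noteq> s \<longrightarrow>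
        (\<exists>!q. q \<in> D \<and> coord r p = coord r q \<and> coord s p = coord s q)) \<and>
     (\<forall>q\<in>D. \<forall>r\<in>{1,2,3}. \<forall>s\<in>{1,2,3}. r \<noteq> s \<longrightarrow>
        (\<exists>!p. p \<in> S \<and> coord r q = coord r p \<and> coord s q = coord s p)) \<and>
     (\<forall>r\<in>{1,2,3}. \<forall>s\<in>{1,2,3}. r \<noteq> s \<longrightarrow> labels r (S \<union> D) \<inter> labels s (S \<union> D) = {})"

(* A bitrade is nonempty iff its first component is, since each component determines whether
   the other one is empty. *)
definition indecomposable_bitrade :: "'a triple set \<Rightarrow> 'a triple set \<Rightarrow> bool" where
  "indecomposable_bitrade S D \<longleftrightarrow>
     latin_bitrade S D \<and>
     \<not> (\<exists>S1 D1 S2 D2. latin_bitrade S1 D1 \<and> latin_bitrade S2 D2 \<and>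
          S1 \<noteq> {} \<and> S2 \<noteq> {} \<and>
          S1 \<inter> S2 = {} \<and> D1 \<inter> D2 = {} \<and>
          S = S1 \<union> S2 \<and> D = D1 \<union> D2)"

definition spherical_bitrade :: "'a triple set \<Rightarrow> 'a triple set \<Rightarrow> bool" where
  "spherical_bitrade S D \<longleftrightarrow>
     indecomposable_bitrade S D \<and>
     card (labels 1 S) + card (labels 2 S) + card (labels 3 S) = card S + 2"

(* The three maps are the functions f 1, f 2, f 3; their values outside the i-th label set
   are irrelevant. The group operation is written multiplicatively, as in HOL-Algebra. *)
definition homotopy_into ::
    "'a triple set \<Rightarrow> ('g, 'b) monoid_scheme \<Rightarrow> (nat \<Rightarrow> 'a \<Rightarrow> 'g) \<Rightarrow> bool" where
  "homotopy_into S G f \<longleftrightarrow>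
     comm_group G \<and>
     (\<forall>i\<in>{1,2,3}. f i \<in> labels i S \<rightarrow> carrier G) \<and>
     (\<forall>(x, y, z)\<in>S. f 1 x \<otimes>\<^bsub>G\<^esub> f 2 y = f 3 z)"

end

theory Submission
  imports Defs Complex_Main
begin

text \<open>
  Changing the sign on symbols turns homotopies into triples of functions whose sum vanishes on
  \<open>S\<close>. The sum over \<open>D\<close> of the squares of the coordinate sums equals that over \<open>S\<close>, because
  expanding the squares only involves pairs of coordinates. Hence a rational homotopy of \<open>S\<close> is
  one of \<open>D\<close> too, and connectedness makes it constant in each coordinate. As \<open>m = s + 2\<close>, the
  equations of \<open>S\<close> are therefore independent, so every \<open>p\<close> in \<open>S\<close> has a rational \<open>f p\<close> with
  coordinate sum 1 at \<open>p\<close> and 0 elsewhere on \<open>S\<close>. Modulo 1 this is a homotopy into a finite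
  cyclic group.

  A maximum principle shows that in each coordinate the values of \<open>f p\<close> lie in a half-open
  interval of length 1, so two of them agree modulo 1 only if they are equal. Since the
  functions \<open>f p\<close> together with the constants span all functions, two different labels
  cannot have equal values under every \<open>f p\<close>.
\<close>

section \<open>Coordinate sums and linear algebra\<close>

definition coord_sum :: "(nat \<Rightarrow> 'a \<Rightarrow> rat) \<Rightarrow> 'a triple \<Rightarrow> rat" where
  "coord_sum h p = h 1 (coord 1 p) + h 2 (coord 2 p) + h 3 (coord 3 p)"

lemma other_indices:
  assumes "i \<in> {1, 2, 3::nat}"
  obtains j k where "j \<in> {1, 2, 3}" "k \<in> {1, 2, 3}" "i \<noteq> j" "i \<noteq> k" "j \<noteq> k"
    "\<And>h (p :: 'a triple). coord_sum h p = h i (coord i p) + h j (coord j p) + h k (coord k p)"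
proof -
  consider "i = 1" | "i = 2" | "i = 3" using assms by auto
  then show thesis
  proof cases
    case 1 then show thesis by (intro that[of 2 3]) (auto simp: coord_sum_def)
  next
    case 2 then show thesis by (intro that[of 1 3]) (auto simp: coord_sum_def)
  next
    case 3 then show thesis by (intro that[of 1 2]) (auto simp: coord_sum_def)
  qed
qed

text \<open>Gaussian elimination: a nonzero coefficient \<open>l w\<close> serves as a pivot that
  removes one equation and one variable. Strong induction is used because eliminated equations may
  coincide.\<close>

lemma underdetermined_system:
  fixes F :: "('v \<Rightarrow> 'f::field) set"
  assumes "finite F" "finite V" "card F < card V"
  shows "\<exists>x. (\<exists>v\<in>V. x v \<noteq> 0) \<and> (\<forall>l\<in>F. (\<Sum>v\<in>V. l v * x v) = 0)"
  using assms
proof (induction "card F" arbitrary: F V rule: less_induct)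
  case less
  show ?case
  proof (cases "\<exists>l\<in>F. \<exists>v\<in>V. l v \<noteq> 0")
    case False
    obtain v where "v \<in> V" using less.prems by fastforce
    with False show ?thesis by (intro exI[of _ "\<lambda>_. 1"]) auto
  next
    case True
    then obtain l w where l: "l \<in> F" and w: "w \<in> V" "l w \<noteq> 0" by blast
    define F' where "F' = (\<lambda>m v. m v - m w / l w * l v) ` (F - {l})"
    have card_le: "card F' \<le> card (F - {l})"
      unfolding F'_def using less.prems by (intro card_image_le) auto
    have card_F: "card (F - {l}) < card F"
      using l less.prems by (intro card_Diff1_less) auto
    have "card F' < card (V - {w})"
      using card_le l w less.prems card_gt_0_iff[of F] by (auto simp: card_Diff_singleton)
    moreover have "finite F'" using less.prems by (auto simp: F'_def)
    ultimately obtain x where x: "\<exists>v\<in>V - {w}. x v \<noteq> 0"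
      and sol: "\<forall>m\<in>F'. (\<Sum>v\<in>V - {w}. m v * x v) = 0"
      using less.hyps[of F' "V - {w}"] card_le card_F less.prems by fastforce
    define y where "y = x(w := - (\<Sum>v\<in>V - {w}. l v * x v) / l w)"
    have split: "(\<Sum>v\<in>V. m v * y v) = m w * y w + (\<Sum>v\<in>V - {w}. m v * x v)" for m
    proof -
      have "(\<Sum>v\<in>V - {w}. m v * y v) = (\<Sum>v\<in>V - {w}. m v * x v)"
        by (rule sum.cong) (auto simp: y_def)
      then show ?thesis using sum.remove[OF less.prems(2) w(1), of "\<lambda>v. m v * y v"] by simp
    qed
    have "(\<Sum>v\<in>V. m v * y v) = 0" if "m \<in> F" for m
    proof (cases "m = l")
      case True
      then show ?thesis unfolding split using w by (simp add: y_def)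
    next
      case False
      then have "(\<Sum>v\<in>V - {w}. (m v - m w / l w * l v) * x v) = 0"
        using sol that by (auto simp: F'_def)
      then have "(\<Sum>v\<in>V - {w}. m v * x v) - m w / l w * (\<Sum>v\<in>V - {w}. l v * x v) = 0"
        by (simp add: left_diff_distrib sum_subtractf sum_distrib_left mult.assoc)
      then show ?thesis unfolding split using w by (simp add: y_def)
    qed
    moreover have "\<exists>v\<in>V. y v \<noteq> 0" using x by (auto simp: y_def)
    ultimately show ?thesis by blast
  qed
qed

section \<open>Sums over \<open>S\<close> and over \<open>D\<close>\<close>

locale bitrade =
  fixes S D :: "'a triple set"
  assumes bitrade: "latin_bitrade S D"
begin

lemma finite_S: "finite S" and finite_D: "finite D"
  using bitrade by (auto simp: latin_bitrade_def)

lemma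
  assumes "r \<in> {1, 2, 3}" "s \<in> {1, 2, 3}" "r \<noteq> s"
  shows ex1_mate_D: "p \<in> S \<Longrightarrow> \<exists>!q. q \<in> D \<and> coord r p = coord r q \<and> coord s p = coord s q"
    and ex1_mate_S: "q \<in> D \<Longrightarrow> \<exists>!p. p \<in> S \<and> coord r q = coord r p \<and> coord s q = coord s p"
proof -
  have D: "\<forall>p\<in>S. \<forall>r\<in>{1,2,3}. \<forall>s\<in>{1,2,3}. r \<noteq> s \<longrightarrow>
      (\<exists>!q. q \<in> D \<and> coord r p = coord r q \<and> coord s p = coord s q)"
    and S: "\<forall>q\<in>D. \<forall>r\<in>{1,2,3}. \<forall>s\<in>{1,2,3}. r \<noteq> s \<longrightarrow>
      (\<exists>!p. p \<in> S \<and> coord r q = coord r p \<and> coord s q = coord s p)"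
    using bitrade unfolding latin_bitrade_def by - (elim conjE, assumption)+
  show "\<exists>!q. q \<in> D \<and> coord r p = coord r q \<and> coord s p = coord s q" if "p \<in> S"
    by (rule D[rule_format, OF that assms])
  show "\<exists>!p. p \<in> S \<and> coord r q = coord r p \<and> coord s q = coord s p" if "q \<in> D"
    by (rule S[rule_format, OF that assms])
qed

definition mate :: "nat \<Rightarrow> nat \<Rightarrow> 'a triple \<Rightarrow> 'a triple" where
  "mate r s q = (THE p. p \<in> S \<and> coord r q = coord r p \<and> coord s q = coord s p)"

context
  fixes r s :: nat
  assumes rs: "r \<in> {1, 2, 3}" "s \<in> {1, 2, 3}" "r \<noteq> s"
begin

lemma mate:
  assumes "q \<in> D"
  shows "mate r s q \<in> S" "coord r (mate r s q) = coord r q" "coord s (mate r s q) = coord s q"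
  using theI'[OF ex1_mate_S[OF rs assms]] unfolding mate_def by simp_all

lemma mate_eq:
  assumes "p \<in> S" "q \<in> D" "coord r p = coord r q" "coord s p = coord s q"
  shows "p = mate r s q"
  using ex1_mate_S[OF rs assms(2)] mate[OF assms(2)] assms by metis

lemma inj_on_mate: "inj_on (mate r s) D"
proof (rule inj_onI)
  fix q q' assume "q \<in> D" "q' \<in> D" "mate r s q = mate r s q'"
  then show "q = q'" using ex1_mate_D[OF rs, of "mate r s q"] mate[of q] mate[of q'] by metis
qed

lemma image_mate: "mate r s ` D = S"
proof
  show "mate r s ` D \<subseteq> S" using mate by auto
  show "S \<subseteq> mate r s ` D"
  proof
    fix p assume p: "p \<in> S"
    then obtain q where "q \<in> D" "coord r p = coord r q" "coord s p = coord s q"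
      using ex1_mate_D[OF rs] by blast
    then show "p \<in> mate r s ` D" using mate_eq[OF p] by blast
  qed
qed

text \<open>The map \<open>mate r s\<close> is a bijection from \<open>D\<close> onto
  \<open>S\<close> that preserves coordinates \<open>r\<close> and \<open>s\<close>, so it reindexes
  the sum.\<close>

lemma sum_pair_eq: "(\<Sum>q\<in>D. f (coord r q) (coord s q)) = (\<Sum>p\<in>S. f (coord r p) (coord s p))"
proof -
  have "(\<Sum>p\<in>S. f (coord r p) (coord s p))
      = (\<Sum>q\<in>D. f (coord r (mate r s q)) (coord s (mate r s q)))"
    by (rule sum.reindex_bij_betw[symmetric]) (simp add: bij_betw_def inj_on_mate image_mate)
  also have "\<dots> = (\<Sum>q\<in>D. f (coord r q) (coord s q))"
    by (rule sum.cong) (auto simp: mate)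
  finally show ?thesis ..
qed

end

lemma sum_coord_eq:
  assumes "r \<in> {1, 2, 3}"
  shows "(\<Sum>q\<in>D. f (coord r q)) = (\<Sum>p\<in>S. f (coord r p))"
proof -
  obtain s where "s \<in> {1, 2, 3}" "r \<noteq> s" using other_indices[OF assms] by metis
  then show ?thesis using sum_pair_eq[OF assms, of s "\<lambda>x y. f x"] by simp
qed

lemma sum_squares_eq: "(\<Sum>q\<in>D. (coord_sum h q)\<^sup>2) = (\<Sum>p\<in>S. (coord_sum h p)\<^sup>2)"
proof -
  let ?c = "\<lambda>i t. h i (coord i t)"
  have square: "(coord_sum h t)\<^sup>2 = (?c 1 t)\<^sup>2 + (?c 2 t)\<^sup>2 + (?c 3 t)\<^sup>2
      + 2 * (?c 1 t * ?c 2 t) + 2 * (?c 1 t * ?c 3 t) + 2 * (?c 2 t * ?c 3 t)" for t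
    by (simp add: coord_sum_def power2_eq_square algebra_simps)
  have idx: "1 \<in> {1, 2, 3::nat}" "2 \<in> {1, 2, 3::nat}" "3 \<in> {1, 2, 3::nat}"
    "1 \<noteq> (2::nat)" "1 \<noteq> (3::nat)" "2 \<noteq> (3::nat)"
    by auto
  show ?thesis
    unfolding square sum.distrib
    by (simp only: sum_coord_eq[OF idx(1), of "\<lambda>x. (h 1 x)\<^sup>2"]
        sum_coord_eq[OF idx(2), of "\<lambda>x. (h 2 x)\<^sup>2"]
        sum_coord_eq[OF idx(3), of "\<lambda>x. (h 3 x)\<^sup>2"]
        sum_pair_eq[OF idx(1,2,4), of "\<lambda>x y. 2 * (h 1 x * h 2 y)"]
        sum_pair_eq[OF idx(1,3,5), of "\<lambda>x y. 2 * (h 1 x * h 3 y)"]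
        sum_pair_eq[OF idx(2,3,6), of "\<lambda>x y. 2 * (h 2 x * h 3 y)"])
qed

text \<open>Each summand is a function of coordinates \<open>i, j\<close> plus one of
  \<open>i, k\<close>, and both can be cut off at \<open>v\<close>, so \<open>sum_pair_eq\<close>
  applies to the two parts.\<close>

lemma sum_star_eq:
  assumes "i \<in> {1, 2, 3}"
  shows "(\<Sum>q\<in>{q \<in> D. coord i q = v}. coord_sum h q - 1)
       = (\<Sum>p\<in>{p \<in> S. coord i p = v}. coord_sum h p - 1)"
proof -
  obtain j k where jk: "j \<in> {1, 2, 3}" "k \<in> {1, 2, 3}" "i \<noteq> j" "i \<noteq> k"
    and cs: "\<And>t. coord_sum h t = h i (coord i t) + h j (coord j t) + h k (coord k t)"
    using other_indices[OF assms] by metis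
  let ?f = "\<lambda>x y. if x = v then h i x + h j y - 1 else 0"
  let ?g = "\<lambda>x y. if x = v then h k y else 0"
  have "(\<Sum>t\<in>{t \<in> T. coord i t = v}. coord_sum h t - 1)
      = (\<Sum>t\<in>T. ?f (coord i t) (coord j t)) + (\<Sum>t\<in>T. ?g (coord i t) (coord k t))"
    if "finite T" for T
    unfolding sum.distrib[symmetric] using that
    by (simp add: sum.inter_filter) (rule sum.cong, auto simp: cs)
  then show ?thesis
    using sum_pair_eq[OF assms jk(1,3), of ?f] sum_pair_eq[OF assms jk(2,4), of ?g]
      finite_S finite_D by simp
qed

section \<open>Closed parts and indecomposability\<close>

text \<open>These are the unions of connected components of the bipartite graph joining
  \<open>p\<close> in \<open>S\<close> to \<open>q\<close> in \<open>D\<close> when they share two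
  coordinates.\<close>

definition closed_part :: "'a triple set \<Rightarrow> 'a triple set \<Rightarrow> bool" where
  "closed_part K H \<longleftrightarrow> K \<subseteq> S \<and> H \<subseteq> D \<and>
     (\<forall>p\<in>S. \<forall>q\<in>D. \<forall>r\<in>{1,2,3}. \<forall>s\<in>{1,2,3}. r \<noteq> s \<longrightarrow>
        coord r p = coord r q \<longrightarrow> coord s p = coord s q \<longrightarrow> (p \<in> K \<longleftrightarrow> q \<in> H))"

text \<open>Partners in two coordinates never leave the pair \<open>K, H\<close>, so the unique
  existence properties restrict to it.\<close>

lemma closed_part_bitrade:
  assumes "closed_part K H"
  shows "latin_bitrade K H"
  unfolding latin_bitrade_def
proof (intro conjI ballI impI)
  have sub: "K \<subseteq> S" "H \<subseteq> D" using assms by (auto simp: closed_part_def)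
  show "finite K" "finite H" using sub finite_S finite_D finite_subset by auto
  show "K \<inter> H = {}" using sub bitrade by (auto simp: latin_bitrade_def)
  have mem: "p \<in> K \<longleftrightarrow> q \<in> H" if "p \<in> S" "q \<in> D" "r \<in> {1,2,3}" "s \<in> {1,2,3}" "r \<noteq> s"
    "coord r p = coord r q" "coord s p = coord s q" for p q r s
  proof -
    have "\<forall>p\<in>S. \<forall>q\<in>D. \<forall>r\<in>{1,2,3}. \<forall>s\<in>{1,2,3}. r \<noteq> s \<longrightarrow>
        coord r p = coord r q \<longrightarrow> coord s p = coord s q \<longrightarrow> (p \<in> K \<longleftrightarrow> q \<in> H)"
      using assms unfolding closed_part_def by (elim conjE)
    from this[rule_format, OF that] show ?thesis .
  qed
  fix r s :: nat assume rs: "r \<in> {1,2,3}" "s \<in> {1,2,3}" "r \<noteq> s"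
  show "labels r (K \<union> H) \<inter> labels s (K \<union> H) = {}"
  proof -
    have "\<forall>r\<in>{1,2,3}. \<forall>s\<in>{1,2,3}. r \<noteq> s \<longrightarrow> labels r (S \<union> D) \<inter> labels s (S \<union> D) = {}"
      using bitrade unfolding latin_bitrade_def by (elim conjE)
    from this[rule_format, OF rs] have "labels r (S \<union> D) \<inter> labels s (S \<union> D) = {}" .
    moreover have "labels t (K \<union> H) \<subseteq> labels t (S \<union> D)" for t
      using sub by (auto simp: labels_def)
    ultimately show ?thesis by blast
  qed
  show "\<exists>!q. q \<in> H \<and> coord r p = coord r q \<and> coord s p = coord s q" if "p \<in> K" for p
  proof -
    have "q \<in> H \<and> coord r p = coord r q \<and> coord s p = coord s q
        \<longleftrightarrow> q \<in> D \<and> coord r p = coord r q \<and> coord s p = coord s q" for q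
      using mem[OF _ _ rs, of p q] that sub by auto
    then show ?thesis using ex1_mate_D[OF rs subsetD[OF sub(1) that]] by (simp only:)
  qed
  show "\<exists>!p. p \<in> K \<and> coord r q = coord r p \<and> coord s q = coord s p" if "q \<in> H" for q
  proof -
    have "p \<in> K \<and> coord r q = coord r p \<and> coord s q = coord s p
        \<longleftrightarrow> p \<in> S \<and> coord r q = coord r p \<and> coord s q = coord s p" for p
      using mem[OF _ _ rs, of p q] that sub by auto
    then show ?thesis using ex1_mate_S[OF rs subsetD[OF sub(2) that]] by (simp only:)
  qed
qed

lemma closed_part_Diff: "closed_part K H \<Longrightarrow> closed_part (S - K) (D - H)"
  by (simp add: closed_part_def)

text \<open>Mates sharing coordinates \<open>i, j\<close> or \<open>i, k\<close> have the same \<open>i\<close>-coordinate, so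
  a level set of an \<open>i\<close>-coordinate is automatically closed in these directions.\<close>

lemma closed_levelI:
  assumes ijk: "i \<in> {1, 2, 3}" "j \<in> {1, 2, 3}" "k \<in> {1, 2, 3}" "i \<noteq> j" "i \<noteq> k" "j \<noteq> k"
    and K: "K = {p \<in> S. P (coord i p)}" and H: "H = {q \<in> D. P (coord i q)}"
    and jk: "\<And>p q. p \<in> S \<Longrightarrow> q \<in> D \<Longrightarrow> coord j p = coord j q \<Longrightarrow> coord k p = coord k q \<Longrightarrow>
        p \<in> K \<longleftrightarrow> q \<in> H"
  shows "closed_part K H"
  unfolding closed_part_def
proof (intro conjI ballI impI)
  show "K \<subseteq> S" "H \<subseteq> D" using K H by auto
  fix p q r s
  assume pq: "p \<in> S" "q \<in> D" and rs: "r \<in> {1,2,3::nat}" "s \<in> {1,2,3::nat}" "r \<noteq> s"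
    and eq: "coord r p = coord r q" "coord s p = coord s q"
  show "p \<in> K \<longleftrightarrow> q \<in> H"
  proof (cases "coord i p = coord i q")
    case True
    then show ?thesis using pq by (simp add: K H)
  next
    case False
    then have "r \<noteq> i" "s \<noteq> i" using eq by auto
    then have "{r, s} = {j, k}" using ijk rs by auto
    then have "coord j p = coord j q \<and> coord k p = coord k q"
      using eq by (auto simp: doubleton_eq_iff)
    then show ?thesis using jk pq by blast
  qed
qed

lemma card_level_eq:
  assumes "i \<in> {1, 2, 3}"
  shows "card {q \<in> D. P (coord i q)} = card {p \<in> S. P (coord i p)}"
proof -
  have "(\<Sum>q\<in>D. if P (coord i q) then 1 else 0 :: nat) = (\<Sum>p\<in>S. if P (coord i p) then 1 else 0)"
    by (rule sum_coord_eq[OF assms])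
  then show ?thesis using finite_S finite_D by (simp add: sum.inter_filter[symmetric])
qed

end

locale indecomposable = bitrade +
  assumes indec: "indecomposable_bitrade S D"
begin

text \<open>The complement of a closed part is closed too, so a proper nonempty \<open>K\<close>
  would decompose the bitrade.\<close>

lemma closed_part_trivial:
  assumes "closed_part K H" "K \<noteq> {}"
  shows "K = S"
proof (rule ccontr)
  assume "K \<noteq> S"
  moreover have "K \<subseteq> S" "H \<subseteq> D" using assms by (auto simp: closed_part_def)
  ultimately have parts: "S - K \<noteq> {}" "S = K \<union> (S - K)" "D = H \<union> (D - H)" by auto
  have "latin_bitrade K H" "latin_bitrade (S - K) (D - H)"
    using assms closed_part_bitrade closed_part_Diff by auto
  with parts assms(2) have "\<exists>S1 D1 S2 D2. latin_bitrade S1 D1 \<and> latin_bitrade S2 D2 \<and>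
      S1 \<noteq> {} \<and> S2 \<noteq> {} \<and> S1 \<inter> S2 = {} \<and> D1 \<inter> D2 = {} \<and> S = S1 \<union> S2 \<and> D = D1 \<union> D2"
    by (intro exI[of _ K] exI[of _ H] exI[of _ "S - K"] exI[of _ "D - H"] conjI) auto
  with indec show False unfolding indecomposable_bitrade_def by (elim conjE notE)
qed

text \<open>By \<open>sum_squares_eq\<close>, a homotopy of one mate into an ordered field is also a homotopy of
  the other, and then adjacent triples carry the same values.\<close>

lemma homotopy_constant:
  assumes zero: "\<And>p. p \<in> S \<Longrightarrow> coord_sum h p = 0"
    and "p \<in> S" "p' \<in> S" "i \<in> {1, 2, 3}"
  shows "h i (coord i p) = h i (coord i p')"
proof -
  have "(\<Sum>q\<in>D. (coord_sum h q)\<^sup>2) = 0" using zero sum_squares_eq[of h] by simp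
  then have zero': "coord_sum h q = 0" if "q \<in> D" for q
    using that finite_D by (simp add: sum_nonneg_eq_0_iff)
  define P where "P t \<longleftrightarrow> (\<forall>i\<in>{1,2,3}. h i (coord i t) = h i (coord i p))" for t
  have "closed_part {t \<in> S. P t} {t \<in> D. P t}"
    unfolding closed_part_def
  proof (intro conjI ballI impI)
    fix u q r s
    assume uq: "u \<in> S" "q \<in> D" and rs: "r \<in> {1,2,3::nat}" "s \<in> {1,2,3::nat}" "r \<noteq> s"
      and eq: "coord r u = coord r q" "coord s u = coord s q"
    have "h i (coord i u) = h i (coord i q)" if "i \<in> {1,2,3}" for i
      using zero[OF uq(1)] zero'[OF uq(2)] rs eq that by (auto simp: coord_sum_def)
    then show "u \<in> {t \<in> S. P t} \<longleftrightarrow> q \<in> {t \<in> D. P t}" using uq by (simp add: P_def)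
  qed auto
  moreover have "p \<in> {t \<in> S. P t}" using assms by (simp add: P_def)
  ultimately have "{t \<in> S. P t} = S" using closed_part_trivial by blast
  then have "P p'" using assms(3) by blast
  then have "h i (coord i p') = h i (coord i p)" using assms(4) unfolding P_def by (rule bspec)
  then show ?thesis ..
qed

end

section \<open>Maximum principle for barycentric coordinates\<close>

text \<open>In the dissection picture the functions \<open>d 1, d 2, d 3\<close> are the barycentric coordinates
  of the lines, triples of \<open>S\<close> are points and triples of \<open>D\<close> are triangles; the three sides
  of the dissected triangle are the lines of \<open>a\<close>.\<close>

locale barycentric = indecomposable +
  fixes a :: "'a triple" and d :: "nat \<Rightarrow> 'a \<Rightarrow> rat"
  assumes a: "a \<in> S"
    and d_a: "\<And>i. i \<in> {1, 2, 3} \<Longrightarrow> d i (coord i a) = 0"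
    and sum_d: "\<And>p. p \<in> S \<Longrightarrow> p \<noteq> a \<Longrightarrow> coord_sum d p = 1"
begin

text \<open>The value at \<open>v\<close> is the average, over the \<open>q\<close> in \<open>D\<close> through \<open>v\<close>, of the values at the
  mates of \<open>q\<close> opposite to \<open>v\<close>, where \<open>a\<close> as a mate counts with the value 1. The factor
  \<open>c = 1\<close> yields the statement for maxima and \<open>c = -1\<close> the one for minima.\<close>

lemma extremal_degenerate:
  assumes i: "i \<in> {1, 2, 3}" and v: "v \<noteq> coord i a" and c: "c \<noteq> 0"
    and ext: "\<And>p. p \<in> S \<Longrightarrow> c * d i (coord i p) \<le> c * d i v" "c \<le> c * d i v"
    and q: "q \<in> D" "coord i q = v"
  shows "coord_sum d q = 1"
proof -
  obtain j k where jk: "j \<in> {1, 2, 3}" "k \<in> {1, 2, 3}" "i \<noteq> j" "i \<noteq> k" "j \<noteq> k"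
    and cs: "\<And>t :: 'a triple. coord_sum d t = d i (coord i t) + d j (coord j t) + d k (coord k t)"
    using other_indices[OF i] by metis
  let ?Q = "{q \<in> D. coord i q = v}" and ?P = "{p \<in> S. coord i p = v}"
  \<comment> \<open>The term at \<open>t\<close> is \<open>c\<close> times the excess of the value
    at \<open>v\<close> over the value at the opposite mate.\<close>
  have nonneg: "0 \<le> c * (coord_sum d t - 1)" if t: "t \<in> ?Q" for t
  proof -
    obtain p where p: "p \<in> S" "coord j t = coord j p" "coord k t = coord k p"
      using ex1_mate_S[OF jk(1,2,5), of t] t by blast
    have "c * (1 - d j (coord j p) - d k (coord k p)) \<le> c * d i v"
    proof (cases "p = a")
      case True
      then show ?thesis using ext(2) d_a jk by simp
    next
      case False
      then have "1 - d j (coord j p) - d k (coord k p) = d i (coord i p)"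
        using sum_d[OF p(1)] cs[of p] by simp
      then show ?thesis using ext(1)[OF p(1)] by simp
    qed
    then show ?thesis using t p by (simp add: cs algebra_simps)
  qed
  have "(\<Sum>t\<in>?Q. c * (coord_sum d t - 1)) = c * (\<Sum>p\<in>?P. coord_sum d p - 1)"
    by (simp only: sum_distrib_left[symmetric] sum_star_eq[OF i])
  \<comment> \<open>No triple of \<open>S\<close> through \<open>v\<close> is \<open>a\<close>, so
    every term of the star sum over \<open>S\<close> vanishes.\<close>
  also have "(\<Sum>p\<in>?P. coord_sum d p - 1) = 0"
    using sum_d v by (intro sum.neutral) auto
  finally have "(\<Sum>t\<in>?Q. c * (coord_sum d t - 1)) = 0" by simp
  then have "\<forall>t\<in>?Q. c * (coord_sum d t - 1) = 0"
    by (rule sum_nonneg_eq_0_iff[OF _ nonneg, THEN iffD1, rotated 2]) (use finite_D in auto)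
  moreover have "q \<in> ?Q" using q by simp
  ultimately have "c * (coord_sum d q - 1) = 0" by (rule bspec)
  then show ?thesis using c by simp
qed

text \<open>If the bound fails, the extremal level \<open>M\<close> is neither 0 nor 1. Every triple
  of \<open>D\<close> at this level is degenerate, so its mate sharing coordinates
  \<open>j, k\<close> is again at level \<open>M\<close>; equal counts make the level closed, hence
  everything, although \<open>a\<close> is at level 0.\<close>

lemma extremal_bound:
  assumes i: "i \<in> {1, 2, 3}" and c: "c \<noteq> 0" and p: "p \<in> S"
    and ext: "\<And>p'. p' \<in> S \<Longrightarrow> c * d i (coord i p') \<le> c * d i (coord i p)"
  shows "c * d i (coord i p) \<le> max 0 c"
proof (rule ccontr)
  assume "\<not> ?thesis"
  then have big: "0 < c * d i (coord i p)" "c < c * d i (coord i p)" by auto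
  obtain j k where jk: "j \<in> {1, 2, 3}" "k \<in> {1, 2, 3}" "i \<noteq> j" "i \<noteq> k" "j \<noteq> k"
    and cs: "\<And>t :: 'a triple. coord_sum d t = d i (coord i t) + d j (coord j t) + d k (coord k t)"
    using other_indices[OF i] by metis
  define \<pi> where "\<pi> = mate j k"
  note \<pi> = mate[OF jk(1,2,5), folded \<pi>_def] and \<pi>_eq = mate_eq[OF jk(1,2,5), folded \<pi>_def]
    and inj = inj_on_mate[OF jk(1,2,5), folded \<pi>_def]
  define M where "M = d i (coord i p)"
  define K where "K = {t \<in> S. d i (coord i t) = M}"
  define H where "H = {t \<in> D. d i (coord i t) = M}"
  have M: "M \<noteq> 0" "M \<noteq> 1" using big by (auto simp: M_def)
  have "\<pi> q \<in> K" if "q \<in> H" for q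
  proof -
    have q: "q \<in> D" "d i (coord i q) = M" using that by (auto simp: H_def)
    have "coord i q \<noteq> coord i a" using q d_a[OF i] M by auto
    then have one: "coord_sum d q = 1"
      using extremal_degenerate[OF i _ c _ _ q(1) refl] ext big q unfolding M_def by auto
    \<comment> \<open>With \<open>a\<close> as mate, the coordinate sum of \<open>q\<close> would be
      \<open>M\<close> instead of 1.\<close>
    have "\<pi> q \<noteq> a"
    proof
      assume "\<pi> q = a"
      then have "d j (coord j q) = 0" "d k (coord k q) = 0"
        using \<pi>(2,3)[OF q(1)] d_a jk by metis+
      then show False using one q M cs by simp
    qed
    then show ?thesis
      using sum_d[of "\<pi> q"] one \<pi>[OF q(1)] q by (simp add: cs K_def)
  qed
  then have "\<pi> ` H \<subseteq> K" by auto
  moreover have "inj_on \<pi> H" using inj by (rule inj_on_subset) (auto simp: H_def)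
  then have "card (\<pi> ` H) = card K"
    using card_level_eq[OF i, of "\<lambda>x. d i x = M"] by (simp add: card_image H_def K_def)
  ultimately have img: "\<pi> ` H = K"
    using finite_S by (intro card_subset_eq) (auto simp: K_def)
  have "closed_part K H"
  proof (rule closed_levelI[OF i jk, where P = "\<lambda>x. d i x = M"])
    fix u q assume "u \<in> S" "q \<in> D" "coord j u = coord j q" "coord k u = coord k q"
    then show "u \<in> K \<longleftrightarrow> q \<in> H"
      using \<pi>_eq img inj_on_image_mem_iff[OF inj, of q H] by (auto simp: H_def)
  qed (simp_all add: K_def H_def)
  moreover have "p \<in> K" using p by (simp add: K_def M_def)
  ultimately have "K = S" using closed_part_trivial by blast
  then have "a \<in> K" using a by simp
  then show False using d_a[OF i] M by (simp add: K_def)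
qed

lemma d_bounds:
  assumes i: "i \<in> {1, 2, 3}" and p: "p \<in> S"
  shows "0 \<le> d i (coord i p)" "d i (coord i p) \<le> 1"
proof -
  have ex: "\<exists>u\<in>S. \<forall>t\<in>S. c * d i (coord i t) \<le> c * d i (coord i u)" for c
  proof -
    have "finite ((\<lambda>t. c * d i (coord i t)) ` S)" "(\<lambda>t. c * d i (coord i t)) ` S \<noteq> {}"
      using finite_S p by auto
    from Max_in[OF this] Max_ge[OF this(1)] show ?thesis by fastforce
  qed
  have "c * d i (coord i p) \<le> max 0 c" if "c \<noteq> 0" for c
    using ex[of c] extremal_bound[OF i that] p by (meson order_trans)
  from this[of 1] this[of "-1"] show "0 \<le> d i (coord i p)" "d i (coord i p) \<le> 1" by auto
qed

text \<open>The part of the bitrade collapsed to the corner where \<open>d i = 1\<close> could only be left by the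
  adjacency between \<open>a\<close> and its mate sharing coordinates \<open>j, k\<close>; counting rules this out.\<close>

lemma d_less_1:
  assumes i: "i \<in> {1, 2, 3}" and p: "p \<in> S"
  shows "d i (coord i p) < 1"
proof (rule ccontr)
  assume "\<not> ?thesis"
  then have dp: "d i (coord i p) = 1" using d_bounds[OF i p] by simp
  obtain j k where jk: "j \<in> {1, 2, 3}" "k \<in> {1, 2, 3}" "i \<noteq> j" "i \<noteq> k" "j \<noteq> k"
    and cs: "\<And>t :: 'a triple. coord_sum d t = d i (coord i t) + d j (coord j t) + d k (coord k t)"
    using other_indices[OF i] by metis
  define \<pi> where "\<pi> = mate j k"
  note \<pi> = mate[OF jk(1,2,5), folded \<pi>_def] and \<pi>_eq = mate_eq[OF jk(1,2,5), folded \<pi>_def]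
    and inj = inj_on_mate[OF jk(1,2,5), folded \<pi>_def]
    and surj = image_mate[OF jk(1,2,5), folded \<pi>_def]
  define K where "K = {t \<in> S. d i (coord i t) = 1}"
  define H where "H = {t \<in> D. d i (coord i t) = 1}"
  \<comment> \<open>Values are at least 0, so a label of value 0 that is not on \<open>a\<close> is
    extremal for \<open>c = -1\<close>.\<close>
  have degenerate: "coord_sum d q = 1"
    if q: "q \<in> D" and r: "r \<in> {1, 2, 3}" "coord r q \<noteq> coord r a" "d r (coord r q) = 0" for q r
    by (rule extremal_degenerate[OF r(1,2), of "-1"]) (use d_bounds(1)[OF r(1)] q r in auto)
  have "K \<subseteq> \<pi> ` H"
  proof
    fix u assume u: "u \<in> K"
    then have "u \<in> S" "d i (coord i u) = 1" "u \<noteq> a" using d_a[OF i] by (auto simp: K_def)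
    then have "d j (coord j u) + d k (coord k u) = 0" using sum_d[of u] cs[of u] by simp
    moreover have "0 \<le> d j (coord j u)" "0 \<le> d k (coord k u)"
      using d_bounds(1) jk \<open>u \<in> S\<close> by auto
    ultimately have zero: "d j (coord j u) = 0" "d k (coord k u) = 0" by linarith+
    obtain q where q: "q \<in> D" "u = \<pi> q" using surj \<open>u \<in> S\<close> by blast
    \<comment> \<open>Otherwise \<open>a\<close> would be the mate \<open>u\<close> of
      \<open>q\<close>. Hence \<open>q\<close> has a label of value 0 off \<open>a\<close>, which
      makes it degenerate.\<close>
    have "\<not> (coord j q = coord j a \<and> coord k q = coord k a)"
      using \<pi>_eq[OF a q(1)] q \<open>u \<noteq> a\<close> by auto
    then have "coord_sum d q = 1"
      using degenerate[OF q(1) jk(1)] degenerate[OF q(1) jk(2)] zero \<pi>(2,3)[OF q(1)] q(2) by auto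
    then have "q \<in> H" using zero q \<pi>(2,3)[OF q(1)] by (simp add: H_def cs)
    then show "u \<in> \<pi> ` H" using q by blast
  qed
  moreover have "inj_on \<pi> H" using inj by (rule inj_on_subset) (auto simp: H_def)
  then have "card (\<pi> ` H) = card K"
    using card_level_eq[OF i, of "\<lambda>x. d i x = 1"] by (simp add: card_image H_def K_def)
  ultimately have img: "\<pi> ` H = K"
    using finite_D by (intro card_subset_eq[symmetric]) (auto simp: H_def)
  have "closed_part K H"
  proof (rule closed_levelI[OF i jk, where P = "\<lambda>x. d i x = 1"])
    fix u q assume "u \<in> S" "q \<in> D" "coord j u = coord j q" "coord k u = coord k q"
    then show "u \<in> K \<longleftrightarrow> q \<in> H"
      using \<pi>_eq img inj_on_image_mem_iff[OF inj, of q H] by (auto simp: H_def)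
  qed (simp_all add: K_def H_def)
  moreover have "p \<in> K" using p dp by (simp add: K_def)
  ultimately have "K = S" using closed_part_trivial by blast
  then have "a \<in> K" using a by simp
  then show False using d_a[OF i] by (simp add: K_def)
qed

end

section \<open>Dual functions\<close>

text \<open>The equation at \<open>a\<close> is replaced by two conditions fixing the additive
  constants, which leaves at most \<open>card S + 1\<close> equations in \<open>card S + 2\<close>
  unknowns. A nonzero solution violates the equation at \<open>a\<close>: it would otherwise be
  constant in each coordinate, hence zero. Scaling then gives \<open>f\<close>.\<close>

lemma (in indecomposable) dual_function:
  assumes card: "card (labels 1 S) + card (labels 2 S) + card (labels 3 S) = card S + 2"
    and a: "a \<in> S"
  shows "\<exists>f. \<forall>p\<in>S. coord_sum f p = (if p = a then 1 else 0)"
proof -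
  define V where "V = Sigma {1, 2, 3::nat} (\<lambda>i. labels i S)"
  define inc :: "'a triple \<Rightarrow> nat \<times> 'a \<Rightarrow> rat"
    where "inc p = (\<lambda>v. if snd v = coord (fst v) p then 1 else 0)" for p
  define pt :: "nat \<Rightarrow> nat \<times> 'a \<Rightarrow> rat"
    where "pt i = (\<lambda>v. if v = (i, coord i a) then 1 else 0)" for i
  define F where "F = inc ` (S - {a}) \<union> {pt 1, pt 2}"
  have fin: "finite (labels i S)" for i using finite_S by (simp add: labels_def)
  have finV: "finite V" using fin by (auto simp: V_def)
  have cardV: "card V = card S + 2" using card fin by (simp add: V_def)
  have finF: "finite F" using finite_S by (simp add: F_def)
  have "card F \<le> card (inc ` (S - {a})) + card {pt 1, pt 2}" unfolding F_def by (rule card_Un_le)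
  also have "\<dots> \<le> card (S - {a}) + 2"
    using card_image_le[of "S - {a}" inc] finite_S by (intro add_mono) (auto simp: card_insert_if)
  also have "\<dots> < card V"
    using card_Diff1_less[OF finite_S a] cardV by simp
  finally obtain x where x: "\<exists>v\<in>V. x v \<noteq> 0" and sol: "\<forall>l\<in>F. (\<Sum>v\<in>V. l v * x v) = 0"
    using underdetermined_system[OF finF finV] by blast
  define h where "h i y = x (i, y)" for i y
  have coord_sum_h: "(\<Sum>v\<in>V. inc p v * x v) = coord_sum h p" if p: "p \<in> S" for p
  proof -
    have "(\<Sum>v\<in>V. inc p v * x v) = (\<Sum>i\<in>{1,2,3}. \<Sum>y\<in>labels i S. inc p (i, y) * x (i, y))"
      unfolding V_def using fin by (subst sum.Sigma) auto
    also have "\<dots> = (\<Sum>i\<in>{1,2,3}. h i (coord i p))"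
    proof (rule sum.cong)
      fix i :: nat
      have "(\<Sum>y\<in>labels i S. inc p (i, y) * x (i, y))
          = (\<Sum>y\<in>labels i S. if y = coord i p then x (i, y) else 0)"
        by (rule sum.cong) (auto simp: inc_def)
      also have "\<dots> = h i (coord i p)" using fin p by (simp add: h_def labels_def)
      finally show "(\<Sum>y\<in>labels i S. inc p (i, y) * x (i, y)) = h i (coord i p)" .
    qed simp
    finally show ?thesis by (simp add: coord_sum_def)
  qed
  have pt0: "h i (coord i a) = 0" if "i \<in> {1, 2}" for i
  proof -
    have "(\<Sum>v\<in>V. pt i v * x v) = 0" using sol that by (auto simp: F_def)
    moreover have "(\<Sum>v\<in>V. pt i v * x v) = (\<Sum>v\<in>V. if v = (i, coord i a) then x v else 0)"
      by (rule sum.cong) (auto simp: pt_def)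
    moreover have "(i, coord i a) \<in> V" using that a by (auto simp: V_def labels_def)
    ultimately show ?thesis using finV by (simp add: h_def)
  qed
  have zero: "coord_sum h p = 0" if "p \<in> S" "p \<noteq> a" for p
    using sol coord_sum_h[OF that(1)] that by (auto simp: F_def)
  have "coord_sum h a \<noteq> 0"
  proof
    assume a0: "coord_sum h a = 0"
    then have hom: "coord_sum h p = 0" if "p \<in> S" for p using zero that by blast
    have a3: "h 3 (coord 3 a) = 0" using a0 pt0 by (simp add: coord_sum_def)
    have "h i (coord i p) = 0" if "p \<in> S" "i \<in> {1, 2, 3}" for i p
      using homotopy_constant[of h, OF hom that(1) a that(2)] pt0[of i] a3 that by auto
    then have "\<forall>v\<in>V. x v = 0" by (auto simp: V_def labels_def h_def)
    then show False using x by blast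
  qed
  then show ?thesis
    using zero by (intro exI[of _ "\<lambda>i y. h i y / coord_sum h a"])
      (auto simp: coord_sum_def add_divide_distrib[symmetric])
qed

section \<open>Passage to finite cyclic groups\<close>

lemma common_denominator:
  fixes A :: "rat set"
  assumes "finite A"
  shows "\<exists>N::nat. N > 0 \<and> (\<forall>x\<in>A. of_nat N * x \<in> \<int>)"
  using assms
proof (induction A rule: finite_induct)
  case empty
  then show ?case by auto
next
  case (insert x A)
  then obtain N where N: "N > 0" "\<forall>x\<in>A. of_nat N * x \<in> \<int>" by blast
  obtain u w where x: "x = Fract u w" "w > 0" by (cases x) auto
  then have wx: "of_int w * x = of_int u" by (simp add: Fract_of_int_quotient)
  have "of_nat (N * nat w) * x = of_int (int N * u)"
    using wx x(2) by (simp add: mult.assoc)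
  moreover have "of_nat (N * nat w) * y \<in> \<int>" if "y \<in> A" for y
  proof -
    have "of_nat (N * nat w) * y = of_nat (nat w) * (of_nat N * y)" by (simp add: ac_simps)
    then show ?thesis using N that by (metis Ints_mult Ints_of_nat)
  qed
  ultimately have "\<forall>y\<in>insert x A. of_nat (N * nat w) * y \<in> \<int>"
    by (metis Ints_of_int insertE)
  then show ?case using N x by (intro exI[of _ "N * nat w"]) auto
qed

text \<open>The passage from \<open>f\<close> to \<open>\<phi>\<close> flips the sign of the symbols, because \<open>coord_sum\<close> is
  symmetric in the three coordinates.\<close>

lemma homotopy_of_rational_function:
  fixes f :: "nat \<Rightarrow> 'a \<Rightarrow> rat"
  assumes fin: "finite S" and ints: "\<And>p. p \<in> S \<Longrightarrow> coord_sum f p \<in> \<int>"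
    and ab: "a \<in> S" "b \<in> S" and i: "i \<in> {1, 2, 3}"
    and sep: "f i (coord i a) - f i (coord i b) \<notin> \<int>"
  shows "\<exists>n \<phi>. n \<ge> 2 \<and> homotopy_into S (integer_mod_group n) \<phi> \<and>
           \<phi> i (coord i a) \<noteq> \<phi> i (coord i b)"
proof -
  have "finite ((\<lambda>(i, p). f i (coord i p)) ` ({1, 2, 3} \<times> S))" using fin by auto
  from common_denominator[OF this] obtain N where N: "N > 0"
    and N_ints: "\<And>i p. i \<in> {1, 2, 3} \<Longrightarrow> p \<in> S \<Longrightarrow> of_nat N * f i (coord i p) \<in> \<int>"
    by auto
  \<comment> \<open>Scaling by \<open>N\<close> turns the values modulo 1 into integers modulo
    \<open>N\<close>; by \<open>N_ints\<close> the floor is exact on the labels of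
    \<open>S\<close>.\<close>
  define g :: "nat \<Rightarrow> 'a \<Rightarrow> int" where "g i x = \<lfloor>of_nat N * f i x\<rfloor>" for i x
  have g: "of_int (g i (coord i p)) = of_nat N * f i (coord i p)"
    if "i \<in> {1, 2, 3}" "p \<in> S" for i p
    using N_ints[OF that] by (simp add: g_def)
  define \<epsilon> :: "nat \<Rightarrow> int" where "\<epsilon> i = (if i = 3 then - 1 else 1)" for i
  define \<phi> where "\<phi> i x = (\<epsilon> i * g i x) mod int N" for i x
  have "N \<noteq> 1"
  proof
    assume "N = 1"
    then show False using N_ints[OF i ab(1)] N_ints[OF i ab(2)] sep by simp
  qed
  then have "N \<ge> 2" using N by simp
  moreover have "homotopy_into S (integer_mod_group N) \<phi>"
    unfolding homotopy_into_def
  proof (intro conjI ballI)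
    show "comm_group (integer_mod_group N)" by simp
    show "\<phi> r \<in> labels r S \<rightarrow> carrier (integer_mod_group N)" for r
      using N by (auto simp: carrier_integer_mod_group \<phi>_def)
    fix p assume p: "p \<in> S"
    obtain x y z where xyz: "p = (x, y, z)" by (cases p)
    obtain m where m: "coord_sum f p = of_int m" using ints[OF p] by (auto elim: Ints_cases)
    have "of_int (g 1 x + g 2 y + g 3 z) = (of_nat N * coord_sum f p :: rat)"
      using g[OF _ p, of 1] g[OF _ p, of 2] g[OF _ p, of 3]
      by (simp add: xyz coord_def coord_sum_def distrib_left)
    also have "\<dots> = of_int (int N * m)" by (simp add: m)
    finally have "g 1 x + g 2 y + g 3 z = int N * m" by (simp only: of_int_eq_iff)
    then have "g 1 x + g 2 y = - g 3 z + int N * m" by simp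
    then have "(g 1 x + g 2 y) mod int N = (- g 3 z) mod int N" by (simp only: mod_mult_self2)
    then show "case p of (x, y, z) \<Rightarrow> \<phi> 1 x \<otimes>\<^bsub>integer_mod_group N\<^esub> \<phi> 2 y = \<phi> 3 z"
      using N by (simp add: xyz \<phi>_def \<epsilon>_def mult_integer_mod_group mod_add_eq)
  qed
  moreover have "\<phi> i (coord i a) \<noteq> \<phi> i (coord i b)"
  proof
    assume "\<phi> i (coord i a) = \<phi> i (coord i b)"
    then have "int N dvd \<epsilon> i * g i (coord i a) - \<epsilon> i * g i (coord i b)"
      by (simp add: \<phi>_def mod_eq_dvd_iff)
    then have "int N dvd \<epsilon> i * (g i (coord i a) - g i (coord i b))"
      by (simp only: right_diff_distrib)
    then have "int N dvd g i (coord i a) - g i (coord i b)"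
      by (auto simp: \<epsilon>_def dvd_diff_commute split: if_splits)
    then obtain m where "g i (coord i a) - g i (coord i b) = int N * m" by (auto elim: dvdE)
    then have "(of_int (g i (coord i a) - g i (coord i b)) :: rat) = of_nat N * of_int m"
      by simp
    then have "of_nat N * (f i (coord i a) - f i (coord i b)) = of_nat N * of_int m"
      using g[OF i] ab by (simp add: right_diff_distrib)
    then have "f i (coord i a) - f i (coord i b) = of_int m" using N by simp
    then show False using sep by simp
  qed
  ultimately show ?thesis by blast
qed

section \<open>Separation of labels\<close>

theorem theorem4p5:
  fixes S D :: "'a triple set" and a b :: "'a triple" and i :: nat
  assumes "spherical_bitrade S D"
    and "a \<in> S" and "b \<in> S" and "i \<in> {1, 2, 3}"
    and "coord i a \<noteq> coord i b"
  shows "\<exists>n \<phi>. n \<ge> 2 \<and> homotopy_into S (integer_mod_group n) \<phi> \<and>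
           \<phi> i (coord i a) \<noteq> \<phi> i (coord i b)"
proof -
  interpret indecomposable S D
    using assms(1)
    by unfold_locales (auto simp: spherical_bitrade_def indecomposable_bitrade_def)
  have card: "card (labels 1 S) + card (labels 2 S) + card (labels 3 S) = card S + 2"
    using assms(1) by (simp add: spherical_bitrade_def)
  obtain f where f: "\<And>p t. p \<in> S \<Longrightarrow> t \<in> S \<Longrightarrow> coord_sum (f p) t = (if t = p then 1 else 0)"
    using dual_function[OF card] by metis
  have "\<exists>p\<in>S. f p i (coord i a) - f p i (coord i b) \<notin> \<int>"
  proof (rule ccontr)
    assume "\<not> ?thesis"
    then have int: "f p i (coord i a) - f p i (coord i b) \<in> \<int>" if "p \<in> S" for p
      using that by blast
    have eq: "f p i (coord i a) = f p i (coord i b)" if p: "p \<in> S" for p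
    proof -
      \<comment> \<open>Measured from \<open>p\<close> with reversed sign, \<open>f p\<close>
        satisfies the barycentric axioms with \<open>p\<close> in the role of the distinguished
        triple.\<close>
      define d where "d r x = f p r (coord r p) - f p r x" for r x
      have "coord_sum d t = coord_sum (f p) p - coord_sum (f p) t" for t
        by (simp add: coord_sum_def d_def)
      then interpret barycentric S D p d
        using p f[OF p] by unfold_locales (auto simp: d_def)
      have "\<bar>d i (coord i b) - d i (coord i a)\<bar> < 1"
        using d_bounds(1)[OF assms(4,2)] d_bounds(1)[OF assms(4,3)]
          d_less_1[OF assms(4,2)] d_less_1[OF assms(4,3)] by linarith
      then have "\<bar>f p i (coord i a) - f p i (coord i b)\<bar> < 1" by (simp add: d_def)
      then show ?thesis using int[OF p] Ints_eq_abs_less1[of _ 0] by force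
    qed
    \<comment> \<open>The indicator of the label \<open>coord i a\<close> is expanded in the
      functions \<open>f p\<close>. The remainder \<open>h\<close> has coordinate sum 0 on
      \<open>S\<close>, hence is constant in coordinate \<open>i\<close>, so the indicator would not
      tell \<open>coord i a\<close> from \<open>coord i b\<close>.\<close>
    define e :: "nat \<Rightarrow> 'a \<Rightarrow> rat" where "e r x = (if r = i \<and> x = coord i a then 1 else 0)" for r x
    define h where "h r x = e r x - (\<Sum>p\<in>S. coord_sum e p * f p r x)" for r x
    have "coord_sum h t = 0" if t: "t \<in> S" for t
    proof -
      have "coord_sum h t = coord_sum e t - (\<Sum>p\<in>S. coord_sum e p * coord_sum (f p) t)"
        by (simp add: coord_sum_def h_def distrib_left sum.distrib)
      also have "(\<Sum>p\<in>S. coord_sum e p * coord_sum (f p) t)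
          = (\<Sum>p\<in>S. if t = p then coord_sum e p else 0)"
        using f t by (intro sum.cong) auto
      also have "\<dots> = coord_sum e t" using finite_S t by simp
      finally show ?thesis by simp
    qed
    then have "h i (coord i a) = h i (coord i b)" using homotopy_constant assms by blast
    moreover have "(\<Sum>p\<in>S. coord_sum e p * f p i (coord i a))
        = (\<Sum>p\<in>S. coord_sum e p * f p i (coord i b))"
      using eq by (intro sum.cong) auto
    ultimately show False using assms(5) by (simp add: h_def e_def)
  qed
  then obtain p where p: "p \<in> S" "f p i (coord i a) - f p i (coord i b) \<notin> \<int>" by blast
  then show ?thesis
    using f by (intro homotopy_of_rational_function[OF finite_S _ assms(2-4), of "f p"]) auto
qed

end
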